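(* For every integer $n\geq 4$, the path $P_4$ divides the hypercube $Q_n$.
   Context: $Q_n$ is the $n$-dimensional hypercube: its vertex set is the set of subsets of $\{1,2,\ldots,n\}$ (equivalently binary strings of length $n$), and two vertices $x,y$ are adjacent iff $|x\,\Delta\, y|=1$. $P_k$ denotes the path with $k$ edges. If $H$ is isomorphic to a subgraph of $G$, we say $H$ divides $G$ if there exist embeddings $\theta_1,\ldots,\theta_m$ of $H$ into $G$ such that $\{E(\theta_1(H)),\ldots,E(\theta_m(H))\}$ is a partition of $E(G)$. *)

theory Defs
  imports Main "HOL-Library.Disjoint_Sets"
begin

record 'a ugraph =
  verts :: "'a set"
  edges :: "'a set set"

definition simple_graph :: "'a ugraph \<Rightarrow> bool" where
  "simple_graph G \<longleftrightarrow> (\<forall>e\<in>edges G. e \<subseteq> verts G \<and> card e = 2)"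

definition subgraph :: "'a ugraph \<Rightarrow> 'a ugraph \<Rightarrow> bool" where
  "subgraph K G \<longleftrightarrow> verts K \<subseteq> verts G \<and> edges K \<subseteq> edges G"

definition image_graph :: "('a \<Rightarrow> 'b) \<Rightarrow> 'a ugraph \<Rightarrow> 'b ugraph" where
  "image_graph f H = \<lparr>verts = f ` verts H, edges = (\<lambda>e. f ` e) ` edges H\<rparr>"

definition embedding :: "('a \<Rightarrow> 'b) \<Rightarrow> 'a ugraph \<Rightarrow> 'b ugraph \<Rightarrow> bool" where
  "embedding f H G \<longleftrightarrow> inj_on f (verts H) \<and> subgraph (image_graph f H) G"

text \<open>
  The first conjunct below says that \<open>H\<close> is isomorphic to a subgraph of \<open>G\<close>; it matters
  only when \<open>G\<close> has no edges, where the partition may be empty (\<open>m = 0\<close>).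
\<close>

definition divides :: "'a ugraph \<Rightarrow> 'b ugraph \<Rightarrow> bool" where
  "divides H G \<longleftrightarrow>
     (\<exists>f. embedding f H G) \<and>
     (\<exists>(m::nat) \<theta>. (\<forall>i\<in>{1..m}. embedding (\<theta> i) H G) \<and>
        partition_on (edges G) ((\<lambda>i. edges (image_graph (\<theta> i) H)) ` {1..m}))"

definition hypercube :: "nat \<Rightarrow> nat set ugraph" where
  "hypercube n = \<lparr>verts = Pow {1..n},
     edges = {{x, y} | x y. x \<in> Pow {1..n} \<and> y \<in> Pow {1..n} \<and> card (sym_diff x y) = 1}\<rparr>"

text \<open>The index of a path counts edges, so \<open>path_graph k\<close> has \<open>k + 1\<close> vertices.\<close>

definition path_graph :: "nat \<Rightarrow> nat ugraph" where
  "path_graph k = \<lparr>verts = {0..k}, edges = {{i, Suc i} | i. i < k}\<rparr>"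

lemma simple_graph_hypercube: "simple_graph (hypercube n)"
proof -
  have "x \<noteq> y" if "card (sym_diff x y) = 1" for x y :: "nat set"
    using that by auto
  then show ?thesis
    by (auto simp: simple_graph_def hypercube_def card_insert_if)
qed

lemma simple_graph_path_graph: "simple_graph (path_graph k)"
  by (auto simp: simple_graph_def path_graph_def card_insert_if)

end

theory Submission
  imports Defs
begin

text \<open>
  Let \<open>n = 2m\<close> or \<open>n = 2m + 1\<close>, put \<open>c = 2m + 1\<close>, and call a direction \<open>d \<noteq> c\<close> odd or even
  by its parity. Send a vertex \<open>x\<close> to the triple consisting of the parity of its number of odd
  elements, that of its even elements, and whether \<open>c \<in> x\<close>. The fibres are cosets of a group
  of translations, so a decomposition of the quotient multigraph, with edges labelled by
  directions, into trails of length 4 lifts to a decomposition of the cube: start each trail at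
  every vertex of the right class. A lifted trail with directions \<open>d1, ..., d4\<close> is a path unless
  two consecutive directions agree or \<open>d1 = d3\<close> and \<open>d2 = d4\<close>.

  Each face \<open>r = (c \<in> x)\<close> of the quotient is a 4-cycle whose edges have multiplicity \<open>m\<close>. It
  splits into the \<open>m\<close> closed trails \<open>2i + 1, 2i + 2, 2i' + 1, 2i' + 2\<close>, where \<open>i'\<close> is the cyclic
  successor of \<open>i < m\<close>. For even \<open>n\<close> this suffices. For odd \<open>n\<close>, remove trail 1 from the face
  without \<open>c\<close> and trails 0 and 1 from the face with \<open>c\<close>; together with the four quotient edges in
  direction \<open>c\<close> the 12 freed edges form four trails, each taking one edge of the first face, then
  \<open>c\<close>, then two edges of the second face.
\<close>

section \<open>Walks and arcs in the cube and their projection to a quotient\<close>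

definition flip :: "'a set \<Rightarrow> 'a \<Rightarrow> 'a set" where
  "flip x d = sym_diff x {d}"

lemma flip_subset: "x \<subseteq> D \<Longrightarrow> d \<in> D \<Longrightarrow> flip x d \<subseteq> D"
  by (auto simp: flip_def)

text \<open>An arc records the tail and the direction, so the order of traversal of an edge is kept.
  The parameter \<open>step\<close> is \<open>flip\<close> in the cube and the induced map in a
  quotient, so one function serves both.\<close>

fun arcs :: "('v \<Rightarrow> 'd \<Rightarrow> 'v) \<Rightarrow> 'v \<Rightarrow> 'd list \<Rightarrow> ('v \<times> 'd) list" where
  "arcs step x [] = []"
| "arcs step x (d # ds) = (x, d) # arcs step (step x d) ds"

fun walk :: "('v \<Rightarrow> 'd \<Rightarrow> 'v) \<Rightarrow> 'v \<Rightarrow> 'd list \<Rightarrow> 'v list" where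
  "walk step x [] = [x]"
| "walk step x (d # ds) = x # walk step (step x d) ds"

lemma length_arcs [simp]: "length (arcs step x ds) = length ds"
  by (induction ds arbitrary: x) auto

lemma length_walk [simp]: "length (walk step x ds) = Suc (length ds)"
  by (induction ds arbitrary: x) auto

lemma flip_flip [simp]: "flip (flip x d) d = x"
  by (auto simp: flip_def)

lemma flip_eq_iff: "flip x d = flip x d' \<longleftrightarrow> d = d'"
  by (auto simp: flip_def)

lemma flip_inj: "flip x d = flip y d \<longleftrightarrow> x = y"
  by (metis flip_flip)

text \<open>Each flip is injective, so tracing back from the \<open>k\<close>-th arc determines the
  start. Hence distinct lifts of one trail never share an arc at the same position.\<close>

lemma arcs_flip_inj:
  assumes "arcs flip x ds ! k = arcs flip y ds ! k" "k < length ds"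
  shows "x = y"
  using assms
proof (induction ds arbitrary: x y k)
  case (Cons d ds)
  then show ?case
    by (cases k) (simp, metis (lifting) Cons.IH arcs.simps(2) flip_inj length_Cons nth_Cons_Suc Suc_less_eq)
qed simp

lemma arcs_subset_Pow:
  assumes "x \<subseteq> D" "set ds \<subseteq> D"
  shows "set (arcs flip x ds) \<subseteq> Pow D \<times> D"
  using assms
proof (induction ds arbitrary: x)
  case (Cons d ds)
  then have "set (arcs flip (flip x d) ds) \<subseteq> Pow D \<times> D"
    by (intro Cons.IH flip_subset) auto
  then show ?case using Cons.prems by auto
qed simp

lemma walk_subset_Pow:
  assumes "x \<subseteq> D" "set ds \<subseteq> D"
  shows "set (walk flip x ds) \<subseteq> Pow D"
  using assms
proof (induction ds arbitrary: x)
  case (Cons d ds)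
  then have "set (walk flip (flip x d) ds) \<subseteq> Pow D"
    by (intro Cons.IH flip_subset) auto
  then show ?case using Cons.prems by auto
qed simp

lemma arcs_hom:
  assumes hom: "\<And>x d. x \<subseteq> D \<Longrightarrow> d \<in> D \<Longrightarrow> \<phi> (flip x d) = step (\<phi> x) d"
    and "x \<subseteq> D" "set ds \<subseteq> D"
  shows "arcs step (\<phi> x) ds = map (map_prod \<phi> id) (arcs flip x ds)"
  using assms(2,3)
proof (induction ds arbitrary: x)
  case (Cons d ds)
  then have "arcs step (\<phi> (flip x d)) ds = map (map_prod \<phi> id) (arcs flip (flip x d) ds)"
    by (intro Cons.IH flip_subset) auto
  then show ?case using Cons.prems hom[of x d] by (simp add: id_def)
qed simp

text \<open>Undoing the earlier flips from \<open>y\<close> leads back to the start of a lift, and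
  the involution \<open>step\<close> does the same below. This is what makes the lifts cover every
  cube arc above the trail.\<close>

lemma arcs_lift:
  assumes hom: "\<And>x d. x \<subseteq> D \<Longrightarrow> d \<in> D \<Longrightarrow> \<phi> (flip x d) = step (\<phi> x) d"
    and invol: "\<And>\<kappa> d. step (step \<kappa> d) d = \<kappa>"
    and "set ds \<subseteq> D" "y \<subseteq> D" "(\<phi> y, d) \<in> set (arcs step u ds)"
  shows "\<exists>x\<subseteq>D. \<phi> x = u \<and> (y, d) \<in> set (arcs flip x ds)"
  using assms(3-)
proof (induction ds arbitrary: u)
  case (Cons d' ds)
  show ?case
  proof (cases "(\<phi> y, d) = (u, d')")
    case True
    then show ?thesis using Cons.prems by auto
  next
    case False
    then obtain x where x: "x \<subseteq> D" "\<phi> x = step u d'" "(y, d) \<in> set (arcs flip x ds)"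
      using Cons.IH[of "step u d'"] Cons.prems by auto
    then have "\<phi> (flip x d') = u"
      using hom[of x d'] invol Cons.prems by simp
    moreover have "(y, d) \<in> set (arcs flip (flip x d') (d' # ds))"
      unfolding arcs.simps flip_flip using x by simp
    ultimately show ?thesis
      using x Cons.prems flip_subset[of x D d'] by (intro exI[of _ "flip x d'"]) simp
  qed
qed simp

section \<open>Paths with four edges, and cube edges as arcs\<close>

lemma edges_path_graph_4: "edges (path_graph 4) = {{0, 1}, {1, 2}, {2, 3}, {3, 4}}"
proof -
  have "edges (path_graph 4) = (\<lambda>i. {i, Suc i}) ` {..<4}"
    by (auto simp: path_graph_def)
  then show ?thesis
    by (simp add: lessThan_Suc numeral_eq_Suc insert_commute)
qed

lemma verts_path_graph_4: "verts (path_graph 4) = {0, 1, 2, 3, 4}"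
  by (auto simp: path_graph_def)

lemma edges_image_path_4:
  "edges (image_graph (nth (walk step x [d1, d2, d3, d4])) (path_graph 4)) =
    (\<lambda>(y, d). {y, step y d}) ` set (arcs step x [d1, d2, d3, d4])"
  by (simp add: image_graph_def edges_path_graph_4)

lemma verts_image_path_4:
  "verts (image_graph (nth (walk step x [d1, d2, d3, d4])) (path_graph 4)) =
    set (walk step x [d1, d2, d3, d4])"
  by (simp add: image_graph_def verts_path_graph_4)

text \<open>Two vertices of a walk agree only if every direction between them occurs an even number
  of times. With consecutive directions distinct this cannot happen after one, two or three steps,
  and after four only by the excluded pattern.\<close>

lemma walk_flip_distinct:
  assumes "d1 \<noteq> d2" "d2 \<noteq> d3" "d3 \<noteq> d4" "\<not> (d1 = d3 \<and> d2 = d4)"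
  shows "distinct (walk flip x [d1, d2, d3, d4])"
proof -
  have 1: "y \<noteq> flip y a" for y and a :: 'a
    by (auto simp: flip_def)
  have 2: "y \<noteq> flip (flip y a) b" if "a \<noteq> b" for y and a b :: 'a
    using that by (metis flip_flip flip_eq_iff)
  have 3: "y \<noteq> flip (flip (flip y a) b) c" if "a \<noteq> b" "b \<noteq> c" for y and a b c :: 'a
    using that by (auto simp: flip_def)
  have 4: "x \<noteq> flip (flip (flip (flip x d1) d2) d3) d4"
  proof
    assume "x = flip (flip (flip (flip x d1) d2) d3) d4"
    then have "flip (flip x d4) d3 = flip (flip x d1) d2"
      by (metis flip_flip)
    \<comment> \<open>Membership of \<open>a\<close> in \<open>x\<close> cancels; the equivalences
      act as exclusive or.\<close>
    then have "a = d4 \<longleftrightarrow> a \<noteq> d3 \<longleftrightarrow> (a = d1 \<longleftrightarrow> a \<noteq> d2)" for a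
      unfolding flip_def by blast
    then show False using assms by metis
  qed
  show ?thesis
    using 1 2 3 4 assms by simp
qed

text \<open>Each edge arises from two pairs, one for each end; \<open>valid\<close> in the lifting
  lemma chooses between them.\<close>

lemma edges_hypercube:
  "edges (hypercube n) = (\<lambda>(y, d). {y, flip y d}) ` (Pow {1..n} \<times> {1..n})" (is "?L = ?R")
proof
  show "?L \<subseteq> ?R"
  proof
    fix e assume "e \<in> ?L"
    then obtain x y where e: "e = {x, y}" "x \<subseteq> {1..n}" "y \<subseteq> {1..n}" "card (sym_diff x y) = 1"
      by (auto simp: hypercube_def)
    then obtain d where d: "sym_diff x y = {d}"
      by (meson card_1_singletonE)
    then have "y = flip x d" "d \<in> {1..n}"
      using e unfolding flip_def by blast+
    then show "e \<in> ?R"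
      using e by (auto intro!: image_eqI[of _ _ "(x, d)"])
  qed
next
  have "{y, flip y d} \<in> ?L" if "y \<subseteq> {1..n}" "d \<in> {1..n}" for y d
  proof -
    have "sym_diff y (flip y d) = {d}" by (auto simp: flip_def)
    then have "card (sym_diff y (flip y d)) = 1" by simp
    moreover have "flip y d \<in> Pow {1..n}" "y \<in> Pow {1..n}" using that flip_subset[OF that] by simp_all
    ultimately show ?thesis
      unfolding hypercube_def ugraph.simps mem_Collect_eq
      by (intro exI[of _ y] exI[of _ "flip y d"] conjI refl)
  qed
  then show "?R \<subseteq> ?L" by auto
qed

section \<open>Lifting a trail decomposition of a quotient to the cube\<close>

text \<open>\<open>T\<close> partitions the valid arcs with directions in \<open>D\<close>, where
  \<open>valid\<close> selects one orientation of each labelled edge. A trail is lifted to every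
  vertex above its start: distinctness and disjointness in the quotient keep the lifts
  edge-disjoint, and the conditions on \<open>ds\<close> make each lift a path.\<close>

lemma divides_hypercube_if_quotient_trails:
  fixes n :: nat and \<phi> :: "nat set \<Rightarrow> 'c" and T :: "('c \<times> nat list) set"
  defines "D \<equiv> {1..n}"
  assumes n: "n \<ge> 1"
    and hom: "\<And>x d. x \<subseteq> D \<Longrightarrow> d \<in> D \<Longrightarrow> \<phi> (flip x d) = step (\<phi> x) d"
    and invol: "\<And>\<kappa> d. step (step \<kappa> d) d = \<kappa>"
    and orient: "\<And>\<kappa> d. valid (step \<kappa> d) d \<longleftrightarrow> \<not> valid \<kappa> d"
    and T: "\<And>u ds. (u, ds) \<in> T \<Longrightarrow> \<exists>d1 d2 d3 d4. ds = [d1, d2, d3, d4] \<and>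
      d1 \<noteq> d2 \<and> d2 \<noteq> d3 \<and> d3 \<noteq> d4 \<and> \<not> (d1 = d3 \<and> d2 = d4)"
    and TD: "\<And>u ds. (u, ds) \<in> T \<Longrightarrow> set ds \<subseteq> D"
    and T_valid: "\<And>u ds \<kappa> d. (u, ds) \<in> T \<Longrightarrow> (\<kappa>, d) \<in> set (arcs step u ds) \<Longrightarrow> valid \<kappa> d"
    and T_distinct: "\<And>u ds. (u, ds) \<in> T \<Longrightarrow> distinct (arcs step u ds)"
    and T_disjoint: "\<And>u ds u' ds' \<kappa> d. (u, ds) \<in> T \<Longrightarrow> (u', ds') \<in> T \<Longrightarrow>
      (\<kappa>, d) \<in> set (arcs step u ds) \<Longrightarrow> (\<kappa>, d) \<in> set (arcs step u' ds') \<Longrightarrow> (u, ds) = (u', ds')"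
    and T_cover: "\<And>\<kappa> d. d \<in> D \<Longrightarrow> valid \<kappa> d \<Longrightarrow> \<exists>(u, ds) \<in> T. (\<kappa>, d) \<in> set (arcs step u ds)"
  shows "divides (path_graph 4) (hypercube n)"
proof -
  define I where "I = {(x, ds). x \<subseteq> D \<and> (\<phi> x, ds) \<in> T}"
  define \<theta> where "\<theta> = (\<lambda>(x :: nat set, ds). nth (walk flip x ds))"
  define E where "E = (\<lambda>(y, d :: nat). {y, flip y d})"
  define P where "P = (\<lambda>t. edges (image_graph (\<theta> t) (path_graph 4)))"
  have P: "P (x, ds) = E ` set (arcs flip x ds)" if "(x, ds) \<in> I" for x ds
  proof -
    obtain d1 d2 d3 d4 where "ds = [d1, d2, d3, d4]"
      using T[of "\<phi> x" ds] \<open>(x, ds) \<in> I\<close> by (auto simp: I_def)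
    then show ?thesis
      by (simp only: P_def \<theta>_def E_def edges_image_path_4 split)
  qed
  have edges: "edges (hypercube n) = E ` (Pow D \<times> D)"
    by (simp add: edges_hypercube E_def D_def)
  have sub: "set (arcs flip x ds) \<subseteq> Pow D \<times> D" if "(x, ds) \<in> I" for x ds
    using that by (intro arcs_subset_Pow TD[of "\<phi> x"]) (auto simp: I_def)
  have proj: "arcs step (\<phi> x) ds = map (map_prod \<phi> id) (arcs flip x ds)" if "(x, ds) \<in> I" for x ds
    using that hom by (intro arcs_hom[of D] TD[of "\<phi> x"]) (auto simp: I_def)
  have emb: "embedding (\<theta> t) (path_graph 4) (hypercube n)" if "t \<in> I" for t
  proof -
    obtain x ds where t: "t = (x, ds)" by force
    with that have x: "x \<subseteq> D" and dsT: "(\<phi> x, ds) \<in> T" by (auto simp: I_def)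
    obtain d1 d2 d3 d4 where ds: "ds = [d1, d2, d3, d4]"
      and d: "d1 \<noteq> d2" "d2 \<noteq> d3" "d3 \<noteq> d4" "\<not> (d1 = d3 \<and> d2 = d4)"
      using T[OF dsT] by blast
    have "distinct (walk flip x ds)"
      unfolding ds by (rule walk_flip_distinct[OF d])
    then have "inj_on (\<theta> t) {..<5}"
      unfolding t \<theta>_def split by (rule inj_on_nth) (simp add: ds)
    moreover have "verts (path_graph 4) = {..<5}"
      by (auto simp: path_graph_def)
    moreover have "set (walk flip x ds) \<subseteq> Pow D"
      using TD[OF dsT] x by (rule walk_subset_Pow[rotated])
    then have "verts (image_graph (\<theta> t) (path_graph 4)) \<subseteq> verts (hypercube n)"
      unfolding t \<theta>_def ds split verts_image_path_4 by (simp add: hypercube_def D_def del: walk.simps)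
    moreover have "P t \<subseteq> edges (hypercube n)"
      using P[of x ds] sub[of x ds] that unfolding t edges by (simp add: image_mono)
    ultimately show ?thesis
      by (simp add: embedding_def subgraph_def P_def)
  qed
  have valid: "valid (\<phi> y) d" if "(x, ds) \<in> I" "(y, d) \<in> set (arcs flip x ds)" for x ds y d
    using T_valid[of "\<phi> x" ds "\<phi> y" d] that proj[of x ds] by (force simp: I_def)
  have E_inj: "(y, d) = (y', d')" if "E (y, d) = E (y', d')" "y \<subseteq> D" "d \<in> D" "valid (\<phi> y) d" "valid (\<phi> y') d'"
    for y d y' d'
  proof -
    from that(1) consider "y = y'" "flip y d = flip y' d'" | "y = flip y' d'" "y' = flip y d"
      unfolding E_def split doubleton_eq_iff by metis
    then show ?thesis
    proof cases
      case 1
      then show ?thesis using flip_eq_iff by metis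
    next
      case 2
      have "flip y d' = y'" unfolding 2(1) by (rule flip_flip)
      then have "d = d'" using 2(2) flip_eq_iff[of y d' d] by simp
      \<comment> \<open>Opposite traversals of one edge start at its two ends, and
        \<open>orient\<close> lets only one of the two arcs be valid.\<close>
      have "\<phi> y' = step (\<phi> y) d" unfolding 2(2) by (rule hom[OF that(2,3)])
      then show ?thesis
        using that(4,5) orient \<open>d = d'\<close> by simp
    qed
  qed
  have arc_disjoint: "(x, ds) = (x', ds')"
    if "(x, ds) \<in> I" "(x', ds') \<in> I" "a \<in> set (arcs flip x ds)" "a \<in> set (arcs flip x' ds')" for x ds x' ds' a
  proof -
    have "map_prod \<phi> id a \<in> set (arcs step (\<phi> x) ds)" "map_prod \<phi> id a \<in> set (arcs step (\<phi> x') ds')"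
      using that proj by auto
    moreover have T': "(\<phi> x, ds) \<in> T" "(\<phi> x', ds') \<in> T"
      using that by (auto simp: I_def)
    ultimately have eq: "\<phi> x = \<phi> x'" "ds = ds'"
      using T_disjoint by (metis prod.collapse prod.inject)+
    \<comment> \<open>Both lifts come from the same trail. Since it uses each quotient arc at most
      once, \<open>a\<close> has the same position in both lifts, and the position determines the
      start.\<close>
    from that(3,4) obtain k k' where k: "k < length ds" "arcs flip x ds ! k = a" "k' < length ds" "arcs flip x' ds ! k' = a"
      using eq by (auto simp: in_set_conv_nth)
    have "arcs step (\<phi> x) ds = map (map_prod \<phi> id) (arcs flip x' ds')"
      using proj[OF that(2)] unfolding eq .
    then have "arcs step (\<phi> x) ds ! k' = map_prod \<phi> id a"
      using k(3,4) eq(2) by simp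
    moreover have "arcs step (\<phi> x) ds ! k = map_prod \<phi> id a"
      using k(1,2) unfolding proj[OF that(1)] by simp
    ultimately have "k = k'"
      using nth_eq_iff_index_eq[OF T_distinct[OF T'(1)], of k k'] k(1,3) eq(2) by simp
    then show ?thesis
      using k arcs_flip_inj[of x ds k x'] eq(2) by simp
  qed
  have P_disjoint: "t = t'" if "t \<in> I" "t' \<in> I" "e \<in> P t" "e \<in> P t'" for t t' e
  proof -
    obtain x ds x' ds' where t: "t = (x, ds)" "t' = (x', ds')" by force
    from that obtain y d y' d' where a: "(y, d) \<in> set (arcs flip x ds)" "e = E (y, d)"
       "(y', d') \<in> set (arcs flip x' ds')" "e = E (y', d')"
      using P[of x ds] P[of x' ds'] unfolding t by auto
    have "(y, d) = (y', d')"
    proof (rule E_inj)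
      show "E (y, d) = E (y', d')" using a by simp
      show "y \<subseteq> D" "d \<in> D" using subsetD[OF sub a(1)] that(1) t by simp_all
      show "valid (\<phi> y) d" using a(1) that(1) t by (intro valid[of x ds]) simp_all
      show "valid (\<phi> y') d'" using a(3) that(2) t by (intro valid[of x' ds']) simp_all
    qed
    then show ?thesis
      using arc_disjoint[of x ds x' ds' "(y, d)"] a that(1,2) unfolding t by simp
  qed
  have cover1: "E (y, d) \<in> \<Union> (P ` I)" if y: "y \<subseteq> D" and d: "d \<in> D" and v: "valid (\<phi> y) d" for y d
  proof -
    obtain u ds where u: "(u, ds) \<in> T" "(\<phi> y, d) \<in> set (arcs step u ds)"
      using T_cover[OF d v] by auto
    have "\<exists>x\<subseteq>D. \<phi> x = u \<and> (y, d) \<in> set (arcs flip x ds)"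
      by (rule arcs_lift[OF hom invol TD[OF u(1)] y u(2)])
    then obtain x where x: "x \<subseteq> D" "\<phi> x = u" "(y, d) \<in> set (arcs flip x ds)"
      by blast
    then have I: "(x, ds) \<in> I"
      using u(1) by (simp add: I_def)
    then have "E (y, d) \<in> P (x, ds)"
      using P x(3) by blast
    then show ?thesis using I by blast
  qed
  have cover: "E (y, d) \<in> \<Union> (P ` I)" if y: "y \<subseteq> D" and d: "d \<in> D" for y d
  proof (cases "valid (\<phi> y) d")
    \<comment> \<open>The reverse arc is valid and has the same edge.\<close>
    case False
    then have "E (flip y d, d) \<in> \<Union> (P ` I)"
      using y d by (intro cover1 flip_subset) (simp_all add: hom orient)
    moreover have "E (flip y d, d) = E (y, d)"
      by (simp add: E_def insert_commute)
    ultimately show ?thesis by simp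
  qed (rule cover1[OF y d])
  \<comment> \<open>\<open>divides\<close> indexes the copies by \<open>{1..m}\<close>, so the lifts
    have to be enumerated.\<close>
  have "finite I"
  proof (rule finite_subset)
    show "I \<subseteq> Pow D \<times> {ds. set ds \<subseteq> D \<and> length ds = 4}"
    proof
      fix t assume "t \<in> I"
      then obtain x ds where t: "t = (x, ds)" "x \<subseteq> D" "(\<phi> x, ds) \<in> T"
        unfolding I_def by blast
      then show "t \<in> Pow D \<times> {ds. set ds \<subseteq> D \<and> length ds = 4}"
        using T[OF t(3)] TD[OF t(3)] by auto
    qed
    show "finite (Pow D \<times> {ds. set ds \<subseteq> D \<and> length ds = 4})"
      by (simp add: D_def finite_lists_length_eq)
  qed
  then obtain h where "bij_betw h {1..card I} I"
    using ex_bij_betw_nat_finite_1 by blast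
  then have h: "h ` {1..card I} = I"
    by (simp add: bij_betw_def)
  \<comment> \<open>\<open>n \<ge> 1\<close> provides the edge \<open>{{}, {1}}\<close>, so there is
    at least one lifted path.\<close>
  have "\<exists>f. embedding f (path_graph 4) (hypercube n)"
    using cover[of "{}" 1] emb n unfolding D_def by auto
  moreover have "partition_on (edges (hypercube n)) (P ` I)"
  proof (rule partition_onI)
    show "\<Union> (P ` I) = edges (hypercube n)"
    proof
      show "\<Union> (P ` I) \<subseteq> edges (hypercube n)"
        using emb unfolding P_def embedding_def subgraph_def by blast
      show "edges (hypercube n) \<subseteq> \<Union> (P ` I)"
        unfolding edges using cover by auto
    qed
    show "disjnt p q" if "p \<in> P ` I" "q \<in> P ` I" "p \<noteq> q" for p q
    proof -
      from that obtain t t' where "p = P t" "q = P t'" "t \<in> I" "t' \<in> I" "t \<noteq> t'"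
        by blast
      then show ?thesis
        unfolding disjnt_iff using P_disjoint[of t t'] by blast
    qed
    show "{} \<notin> P ` I"
      by (auto simp: P_def image_graph_def edges_path_graph_4)
  qed
  moreover have "P ` I = (\<lambda>i. P (h i)) ` {1..card I}"
    using h by (metis image_image)
  moreover have "\<forall>i\<in>{1..card I}. embedding (\<theta> (h i)) (path_graph 4) (hypercube n)"
    using emb h by blast
  ultimately show ?thesis
    unfolding divides_def P_def by (intro conjI exI[of _ "card I"] exI[of _ "\<lambda>i. \<theta> (h i)"]) simp_all
qed

section \<open>The parity quotient of the cube and its orientation\<close>

definition parity_class :: "nat \<Rightarrow> nat set \<Rightarrow> bool \<times> bool \<times> bool" where
  "parity_class c x = (odd (card {d \<in> x. odd d \<and> d \<noteq> c}), odd (card {d \<in> x. even d \<and> d \<noteq> c}), c \<in> x)"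

fun parity_step :: "nat \<Rightarrow> bool \<times> bool \<times> bool \<Rightarrow> nat \<Rightarrow> bool \<times> bool \<times> bool" where
  "parity_step c (p, q, r) d =
    (if d = c then (p, q, \<not> r) else if odd d then (\<not> p, q, r) else (p, \<not> q, r))"

text \<open>
  Orients every quotient edge, and hence every cube edge, so that all trails run forward; edges
  then correspond bijectively to forward arcs.
\<close>

fun forward :: "nat \<Rightarrow> bool \<times> bool \<times> bool \<Rightarrow> nat \<Rightarrow> bool" where
  "forward c (p, q, r) d = (if d = c then \<not> r else odd d = (p = q))"

lemma odd_card_filter_flip:
  assumes "finite x"
  shows "odd (card {e \<in> flip x d. P e}) = (odd (card {e \<in> x. P e}) \<noteq> P d)"
proof (cases "P d")
  case True
  have "{e \<in> flip x d. P e} = (if d \<in> x then {e \<in> x. P e} - {d} else insert d {e \<in> x. P e})"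
    using True by (auto simp: flip_def)
  then show ?thesis
    using assms True card_Suc_Diff1[of "{e \<in> x. P e}" d] by (auto split: if_splits)
next
  case False
  then have "{e \<in> flip x d. P e} = {e \<in> x. P e}" by (auto simp: flip_def)
  then show ?thesis using False by simp
qed

lemma parity_class_flip:
  assumes "finite x"
  shows "parity_class c (flip x d) = parity_step c (parity_class c x) d"
  unfolding parity_class_def odd_card_filter_flip[OF assms] by (auto simp: flip_def)

lemma parity_step_invol: "parity_step c (parity_step c \<kappa> d) d = \<kappa>"
  by (cases \<kappa>) auto

lemma forward_parity_step: "forward c (parity_step c \<kappa> d) d \<longleftrightarrow> \<not> forward c \<kappa> d"
  by (cases \<kappa>) auto

section \<open>Decomposition of a face of the quotient into blocks\<close>

definition cyc :: "nat \<Rightarrow> nat \<Rightarrow> nat" where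
  "cyc m i = (if Suc i = m then 0 else Suc i)"

definition block :: "nat \<Rightarrow> nat \<Rightarrow> nat list" where
  "block m i = [2 * i + 1, 2 * i + 2, 2 * cyc m i + 1, 2 * cyc m i + 2]"

lemma cyc_less: "i < m \<Longrightarrow> cyc m i < m"
  by (auto simp: cyc_def)

lemma cyc_inj: "i < m \<Longrightarrow> j < m \<Longrightarrow> cyc m i = cyc m j \<longleftrightarrow> i = j"
  by (auto simp: cyc_def split: if_splits)

lemma cyc_surj: "j < m \<Longrightarrow> \<exists>i<m. cyc m i = j"
  by (cases j) (auto simp: cyc_def intro: exI[of _ "m - 1"] exI[of _ "j - 1"])

text \<open>For \<open>m = 1\<close> the block is \<open>[1, 2, 1, 2]\<close>, which lifts to closed
  4-cycles; from \<open>m = 2\<close> on, the two halves of a block use different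
  directions.\<close>

lemma cyc_neq: "m \<ge> 2 \<Longrightarrow> cyc m i \<noteq> i"
  by (auto simp: cyc_def)

lemma arcs_block:
  assumes "i < m"
  shows "arcs (parity_step (2 * m + 1)) (False, False, r) (block m i) =
    [((False, False, r), 2 * i + 1), ((True, False, r), 2 * i + 2),
     ((True, True, r), 2 * cyc m i + 1), ((False, True, r), 2 * cyc m i + 2)]"
proof -
  have "2 * i + 2 \<noteq> 2 * m + 1" "2 * cyc m i + 2 \<noteq> 2 * m + 1"
    by presburger+
  then show ?thesis
    using assms cyc_less[OF assms] by (simp add: block_def)
qed

text \<open>The tail fixes \<open>r\<close> and the position in the block; the direction then gives
  the index or its cyclic successor, and \<open>cyc\<close> is injective.\<close>

lemma block_disjoint:
  assumes "i < m" "j < m"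
    and "a \<in> set (arcs (parity_step (2 * m + 1)) (False, False, r) (block m i))"
    and "a \<in> set (arcs (parity_step (2 * m + 1)) (False, False, r') (block m j))"
  shows "r = r' \<and> i = j"
  using assms(3,4) cyc_inj[OF assms(1,2)]
  unfolding arcs_block[OF assms(1)] arcs_block[OF assms(2)] by auto

lemma block_cover:
  assumes "1 \<le> d" "d \<le> 2 * m" "forward (2 * m + 1) (p, q, r) d"
  shows "\<exists>i<m. ((p, q, r), d) \<in> set (arcs (parity_step (2 * m + 1)) (False, False, r) (block m i))"
proof -
  \<comment> \<open>\<open>forward\<close> makes \<open>d\<close> odd exactly when
    \<open>p = q\<close>; \<open>j\<close> indexes the pair \<open>2 * j + 1\<close>,
    \<open>2 * j + 2\<close> that contains \<open>d\<close>.\<close>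
  have "\<exists>j<m. d = 2 * j + (if p = q then 1 else 2)"
    using assms by (intro exI[of _ "(d - 1) div 2"]) (auto elim!: oddE evenE)
  then obtain j where j: "j < m" "d = 2 * j + (if p = q then 1 else 2)"
    by blast
  then obtain i where i: "i < m" "cyc m i = j"
    using cyc_surj by blast
  \<comment> \<open>Arcs with \<open>q = False\<close> form the first half of a block, here block
    \<open>j\<close>; arcs with \<open>q = True\<close> form the second half, here of the cyclic
    predecessor of \<open>j\<close>.\<close>
  show ?thesis
  proof (cases q)
    case True
    then show ?thesis
      using i j by (intro exI[of _ i]) (simp add: arcs_block[simplified])
  next
    case False
    then show ?thesis
      using j by (intro exI[of _ j]) (simp add: arcs_block[simplified])
  qed
qed

lemma block_trail:
  assumes "i < m" "m \<ge> 2"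
  shows "\<exists>d1 d2 d3 d4. block m i = [d1, d2, d3, d4] \<and>
      d1 \<noteq> d2 \<and> d2 \<noteq> d3 \<and> d3 \<noteq> d4 \<and> \<not> (d1 = d3 \<and> d2 = d4)"
    and "set (block m i) \<subseteq> {1..2 * m}"
    and "distinct (arcs (parity_step (2 * m + 1)) (False, False, r) (block m i))"
    and "(\<kappa>, d) \<in> set (arcs (parity_step (2 * m + 1)) (False, False, r) (block m i)) \<Longrightarrow>
      forward (2 * m + 1) \<kappa> d"
proof -
  have *: "2 * i + 2 \<noteq> 2 * j + 1" "2 * i + 1 \<noteq> 2 * j + 2" for i j :: nat
    by presburger+
  show "\<exists>d1 d2 d3 d4. block m i = [d1, d2, d3, d4] \<and>
      d1 \<noteq> d2 \<and> d2 \<noteq> d3 \<and> d3 \<noteq> d4 \<and> \<not> (d1 = d3 \<and> d2 = d4)"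
    using *[of i "cyc m i"] *[of "cyc m i" i] cyc_neq[OF assms(2), of i] by (auto simp: block_def)
  show "set (block m i) \<subseteq> {1..2 * m}"
    using assms(1) cyc_less[OF assms(1)] by (auto simp: block_def)
  show "distinct (arcs (parity_step (2 * m + 1)) (False, False, r) (block m i))"
    unfolding arcs_block[OF assms(1)] by simp
  show "forward (2 * m + 1) \<kappa> d"
    if "(\<kappa>, d) \<in> set (arcs (parity_step (2 * m + 1)) (False, False, r) (block m i))"
    using that assms(1) cyc_less[OF assms(1)] * unfolding arcs_block[OF assms(1)] by auto
qed

section \<open>Cubes of even dimension\<close>

lemma divides_hypercube_even:
  assumes "m \<ge> 2"
  shows "divides (path_graph 4) (hypercube (2 * m))"
proof (rule divides_hypercube_if_quotient_trails)
  let ?c = "2 * m + 1"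
  \<comment> \<open>Here \<open>?c\<close> lies outside \<open>{1..2 * m}\<close>, so every vertex
    has \<open>r = False\<close>; the trails with \<open>r = True\<close> cover the other classes of
    the abstract quotient and have no lifts.\<close>
  let ?T = "{((False, False, r), block m i) | r i. i < m}"
  show "parity_class ?c (flip x d) = parity_step ?c (parity_class ?c x) d"
    if "x \<subseteq> {1..2 * m}" "d \<in> {1..2 * m}" for x d
    using that by (intro parity_class_flip) (auto intro: finite_subset)
  show "parity_step ?c (parity_step ?c \<kappa> d) d = \<kappa>" for \<kappa> d
    by (rule parity_step_invol)
  show "forward ?c (parity_step ?c \<kappa> d) d \<longleftrightarrow> \<not> forward ?c \<kappa> d" for \<kappa> d
    by (rule forward_parity_step)
  show "\<exists>d1 d2 d3 d4. ds = [d1, d2, d3, d4] \<and>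
      d1 \<noteq> d2 \<and> d2 \<noteq> d3 \<and> d3 \<noteq> d4 \<and> \<not> (d1 = d3 \<and> d2 = d4)"
    and "set ds \<subseteq> {1..2 * m}" and "distinct (arcs (parity_step ?c) u ds)"
    if "(u, ds) \<in> ?T" for u ds
    using that block_trail[OF _ assms] by blast+
  show "forward ?c \<kappa> d" if "(u, ds) \<in> ?T" "(\<kappa>, d) \<in> set (arcs (parity_step ?c) u ds)" for u ds \<kappa> d
    using that block_trail(4)[OF _ assms] by blast
  show "(u, ds) = (u', ds')"
    if "(u, ds) \<in> ?T" "(u', ds') \<in> ?T" "(\<kappa>, d) \<in> set (arcs (parity_step ?c) u ds)"
      "(\<kappa>, d) \<in> set (arcs (parity_step ?c) u' ds')" for u ds u' ds' \<kappa> d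
  proof -
    from that obtain r i r' j where *: "i < m" "(u, ds) = ((False, False, r), block m i)"
      "j < m" "(u', ds') = ((False, False, r'), block m j)"
      by blast
    then show ?thesis
      using block_disjoint[OF *(1,3), of "(\<kappa>, d)" r r'] that(3,4) by simp
  qed
  show "\<exists>(u, ds) \<in> ?T. (\<kappa>, d) \<in> set (arcs (parity_step ?c) u ds)"
    if "d \<in> {1..2 * m}" "forward ?c \<kappa> d" for \<kappa> d
  proof -
    obtain p q r where \<kappa>: "\<kappa> = (p, q, r)" by (cases \<kappa>)
    from that obtain i where "i < m" "(\<kappa>, d) \<in> set (arcs (parity_step ?c) (False, False, r) (block m i))"
      using block_cover[of d m p q r] unfolding \<kappa> by auto
    then show ?thesis
      by (intro bexI[of _ "((False, False, r), block m i)"]) auto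
  qed
qed (use assms in simp)

section \<open>Cubes of odd dimension\<close>

text \<open>For \<open>m \<ge> 2\<close>, each row takes an arc of block 1 at
  \<open>r = False\<close>, direction \<open>2 * m + 1\<close>, then at \<open>r = True\<close> an
  arc of block 0 followed by one of block 1. As the rows start at the four classes of the first
  face, every arc of these three blocks is used once. Block 0 is \<open>[1, 2, 3, 4]\<close>;
  \<open>cyc m 1\<close> is 2, or 0 when \<open>m = 2\<close>.\<close>

definition cross_trails :: "nat \<Rightarrow> ((bool \<times> bool \<times> bool) \<times> nat list) set" where
  "cross_trails m =
    {((False, True, False), [2 * cyc m 1 + 2, 2 * m + 1, 1, 4]),
     ((False, False, False), [3, 2 * m + 1, 2, 2 * cyc m 1 + 1]),
     ((True, False, False), [4, 2 * m + 1, 3, 2 * cyc m 1 + 2]),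
     ((True, True, False), [2 * cyc m 1 + 1, 2 * m + 1, 4, 3])}"

text \<open>Separates the directions in the cross trails, so that the finite case checks reduce to
  simplification.\<close>

lemma cross_trails_neq:
  assumes "m \<ge> 2"
  shows "cyc m 1 \<noteq> 1" "cyc m 1 < m" "2 * cyc m 1 + 2 \<noteq> 2 * m + 1" "2 * cyc m 1 + 1 \<noteq> 2 * m + 1"
    "2 * cyc m 1 + 1 \<noteq> 3" "2 * cyc m 1 + 2 \<noteq> 4" "2 * cyc m 1 + 1 \<noteq> 2" "2 * cyc m 1 + 2 \<noteq> 3"
    "2 * cyc m 1 + 1 \<noteq> 4"
    "1 \<noteq> 2 * m + 1" "2 \<noteq> 2 * m + 1" "3 \<noteq> 2 * m + 1" "4 \<noteq> 2 * m + 1"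
proof -
  show *: "cyc m 1 \<noteq> 1" "cyc m 1 < m"
    using assms by (auto simp: cyc_def)
  show "2 * cyc m 1 + 2 \<noteq> 2 * m + 1" "2 * cyc m 1 + 1 \<noteq> 2 * m + 1"
    "2 * cyc m 1 + 1 \<noteq> 3" "2 * cyc m 1 + 2 \<noteq> 4" "2 * cyc m 1 + 1 \<noteq> 2" "2 * cyc m 1 + 2 \<noteq> 3"
    "2 * cyc m 1 + 1 \<noteq> 4"
    "1 \<noteq> 2 * m + 1" "2 \<noteq> 2 * m + 1" "3 \<noteq> 2 * m + 1" "4 \<noteq> 2 * m + 1"
    using * assms by presburger+
qed

lemma cross_trails_cases:
  assumes "(u, ds) \<in> cross_trails m" "m \<ge> 2"
  obtains
    (1) "u = (False, True, False)" "ds = [2 * cyc m 1 + 2, 2 * m + 1, 1, 4]"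
      "arcs (parity_step (2 * m + 1)) u ds = [((False, True, False), 2 * cyc m 1 + 2),
        ((False, False, False), 2 * m + 1), ((False, False, True), 1), ((True, False, True), 4)]"
  | (2) "u = (False, False, False)" "ds = [3, 2 * m + 1, 2, 2 * cyc m 1 + 1]"
      "arcs (parity_step (2 * m + 1)) u ds = [((False, False, False), 3),
        ((True, False, False), 2 * m + 1), ((True, False, True), 2), ((True, True, True), 2 * cyc m 1 + 1)]"
  | (3) "u = (True, False, False)" "ds = [4, 2 * m + 1, 3, 2 * cyc m 1 + 2]"
      "arcs (parity_step (2 * m + 1)) u ds = [((True, False, False), 4),
        ((True, True, False), 2 * m + 1), ((True, True, True), 3), ((False, True, True), 2 * cyc m 1 + 2)]"
  | (4) "u = (True, True, False)" "ds = [2 * cyc m 1 + 1, 2 * m + 1, 4, 3]"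
      "arcs (parity_step (2 * m + 1)) u ds = [((True, True, False), 2 * cyc m 1 + 1),
        ((False, True, False), 2 * m + 1), ((False, True, True), 4), ((False, False, True), 3)]"
proof -
  note neq = cross_trails_neq[OF assms(2)]
  from assms(1) consider
    "(u, ds) = ((False, True, False), [2 * cyc m 1 + 2, 2 * m + 1, 1, 4])"
  | "(u, ds) = ((False, False, False), [3, 2 * m + 1, 2, 2 * cyc m 1 + 1])"
  | "(u, ds) = ((True, False, False), [4, 2 * m + 1, 3, 2 * cyc m 1 + 2])"
  | "(u, ds) = ((True, True, False), [2 * cyc m 1 + 1, 2 * m + 1, 4, 3])"
    unfolding cross_trails_def by blast
  then show thesis
  proof cases
    case 1 then show ?thesis using neq by (intro that(1)) simp_all
  next
    case 2 then show ?thesis using neq by (intro that(2)) simp_all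
  next
    case 3 then show ?thesis using neq by (intro that(3)) simp_all
  next
    case 4 then show ?thesis using neq by (intro that(4)) simp_all
  qed
qed

text \<open>Listed trail by trail, these are the four forward arcs in direction
  \<open>2 * m + 1\<close> and the twelve arcs of the removed blocks.\<close>

lemma arcs_cross_trails:
  assumes "m \<ge> 2"
  shows "(\<Union>(u, ds) \<in> cross_trails m. set (arcs (parity_step (2 * m + 1)) u ds)) =
    {((False, True, False), 2 * cyc m 1 + 2), ((False, False, False), 2 * m + 1),
     ((False, False, True), 1), ((True, False, True), 4),
     ((False, False, False), 3), ((True, False, False), 2 * m + 1),
     ((True, False, True), 2), ((True, True, True), 2 * cyc m 1 + 1),
     ((True, False, False), 4), ((True, True, False), 2 * m + 1),
     ((True, True, True), 3), ((False, True, True), 2 * cyc m 1 + 2),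
     ((True, True, False), 2 * cyc m 1 + 1), ((False, True, False), 2 * m + 1),
     ((False, True, True), 4), ((False, False, True), 3)}"
  using cross_trails_neq[OF assms] unfolding cross_trails_def by (simp add: insert_commute)

lemma divides_hypercube_odd:
  assumes "m \<ge> 2"
  shows "divides (path_graph 4) (hypercube (2 * m + 1))"
proof (rule divides_hypercube_if_quotient_trails)
  let ?c = "2 * m + 1"
  let ?k = "cyc m 1"
  let ?arcs = "arcs (parity_step ?c)"
  let ?B = "{((False, False, r), block m i) | r i. i < m \<and> i \<noteq> 1 \<and> \<not> (r \<and> i = 0)}"
  let ?T = "?B \<union> cross_trails m"
  note neq = cross_trails_neq[OF assms] and cross_arcs = arcs_cross_trails[OF assms]
  have k: "cyc m 0 = 1" "0 < m" "1 < m"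
    using assms by (auto simp: cyc_def)
  have blocks:
    "?arcs (False, False, r) (block m 0) =
      [((False, False, r), 1), ((True, False, r), 2), ((True, True, r), 3), ((False, True, r), 4)]"
    "?arcs (False, False, r) (block m 1) =
      [((False, False, r), 3), ((True, False, r), 4), ((True, True, r), 2 * ?k + 1), ((False, True, r), 2 * ?k + 2)]"
    for r
    unfolding arcs_block[OF k(2)] arcs_block[OF k(3)] k(1) by simp_all
  \<comment> \<open>Apart from direction \<open>?c\<close>, cross trails use only arcs of removed
    blocks, so their disjointness from the kept blocks follows from that of blocks among
    themselves.\<close>
  have cross_removed: "d = ?c \<or> (\<exists>r i. i < m \<and> (i = 1 \<or> r \<and> i = 0) \<and> (\<kappa>, d) \<in> set (?arcs (False, False, r) (block m i)))"
    if "(u, ds) \<in> cross_trails m" "(\<kappa>, d) \<in> set (?arcs u ds)" for u ds \<kappa> d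
  proof -
    have "\<forall>a \<in> set (?arcs u ds). snd a = ?c \<or> a \<in> set (?arcs (False, False, False) (block m 1)) \<or>
        a \<in> set (?arcs (False, False, True) (block m 0)) \<or> a \<in> set (?arcs (False, False, True) (block m 1))"
      using that(1) assms
      by (cases rule: cross_trails_cases) (simp_all only: blocks, simp_all del: arcs.simps)
    then have "d = ?c \<or> (\<kappa>, d) \<in> set (?arcs (False, False, False) (block m 1)) \<or>
        (\<kappa>, d) \<in> set (?arcs (False, False, True) (block m 0)) \<or>
        (\<kappa>, d) \<in> set (?arcs (False, False, True) (block m 1))"
      using that(2) by fastforce
    then show ?thesis using k(2,3) by blast
  qed
  have cross_valid: "forward ?c \<kappa> d"
    if "(u, ds) \<in> cross_trails m" "(\<kappa>, d) \<in> set (?arcs u ds)" for u ds \<kappa> d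
  proof -
    from that(1) assms have "\<forall>a \<in> set (?arcs u ds). forward ?c (fst a) (snd a)"
      by (cases rule: cross_trails_cases) (use neq in \<open>simp_all del: arcs.simps\<close>)
    then show ?thesis
      using that(2) by fastforce
  qed
  have block_ne_c: "d \<noteq> ?c" if "i < m" "(\<kappa>, d) \<in> set (?arcs (False, False, r) (block m i))" for i r \<kappa> d
    using that cyc_less[OF that(1)] unfolding arcs_block[OF that(1)] by (auto; presburger)
  have cross_disjoint: "(u, ds) = (u', ds')"
    if "(u, ds) \<in> cross_trails m" "(u', ds') \<in> cross_trails m" "(\<kappa>, d) \<in> set (?arcs u ds)"
      "(\<kappa>, d) \<in> set (?arcs u' ds')" for u ds u' ds' \<kappa> d
  proof -
    \<comment> \<open>All sixteen pairs of cross trails are compared arc by arc.\<close>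
    have "(u, ds) = (u', ds') \<or> set (?arcs u ds) \<inter> set (?arcs u' ds') = {}"
      by (cases rule: cross_trails_cases[OF that(1) assms];
          cases rule: cross_trails_cases[OF that(2) assms])
        (use neq in \<open>simp_all del: arcs.simps\<close>)
    then show ?thesis
      using that(3,4) by blast
  qed
  have block_cross: False
    if "(u, ds) \<in> ?B" "(u', ds') \<in> cross_trails m" "(\<kappa>, d) \<in> set (?arcs u ds)"
      "(\<kappa>, d) \<in> set (?arcs u' ds')" for u ds u' ds' \<kappa> d
  proof -
    from that(1) obtain r i where *: "i < m" "i \<noteq> 1" "\<not> (r \<and> i = 0)" "u = (False, False, r)" "ds = block m i"
      by blast
    then have a: "(\<kappa>, d) \<in> set (?arcs (False, False, r) (block m i))"
      using that(3) by simp
    from cross_removed[OF that(2,4)] obtain r' j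
      where "j < m" "j = 1 \<or> r' \<and> j = 0" "(\<kappa>, d) \<in> set (?arcs (False, False, r') (block m j))"
      using block_ne_c[OF *(1) a] by blast
    then show False
      using block_disjoint[OF *(1) _ a] * by blast
  qed
  show "parity_class ?c (flip x d) = parity_step ?c (parity_class ?c x) d"
    if "x \<subseteq> {1..?c}" "d \<in> {1..?c}" for x d
    using that by (intro parity_class_flip) (auto intro: finite_subset)
  show "parity_step ?c (parity_step ?c \<kappa> d) d = \<kappa>" for \<kappa> d
    by (rule parity_step_invol)
  show "forward ?c (parity_step ?c \<kappa> d) d \<longleftrightarrow> \<not> forward ?c \<kappa> d" for \<kappa> d
    by (rule forward_parity_step)
  show "\<exists>d1 d2 d3 d4. ds = [d1, d2, d3, d4] \<and>
      d1 \<noteq> d2 \<and> d2 \<noteq> d3 \<and> d3 \<noteq> d4 \<and> \<not> (d1 = d3 \<and> d2 = d4)" if "(u, ds) \<in> ?T" for u ds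
    using that
  proof
    assume "(u, ds) \<in> ?B"
    then show ?thesis using block_trail(1)[OF _ assms] by blast
  next
    assume "(u, ds) \<in> cross_trails m"
    then show ?thesis using assms by (cases rule: cross_trails_cases) (use neq in auto)
  qed
  show "set ds \<subseteq> {1..?c}" if "(u, ds) \<in> ?T" for u ds
    using that
  proof
    assume "(u, ds) \<in> ?B"
    then show ?thesis using block_trail(2)[OF _ assms] by fastforce
  next
    assume "(u, ds) \<in> cross_trails m"
    then show ?thesis using assms by (cases rule: cross_trails_cases) (use neq in auto)
  qed
  show "distinct (?arcs u ds)" if "(u, ds) \<in> ?T" for u ds
    using that
  proof
    assume "(u, ds) \<in> ?B"
    then show ?thesis using block_trail(3)[OF _ assms] by blast
  next
    assume "(u, ds) \<in> cross_trails m"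
    then show ?thesis using assms by (cases rule: cross_trails_cases) (use neq in \<open>auto simp del: arcs.simps\<close>)
  qed
  show "forward ?c \<kappa> d" if uds: "(u, ds) \<in> ?T" and a: "(\<kappa>, d) \<in> set (?arcs u ds)" for u ds \<kappa> d
    using uds
  proof
    assume "(u, ds) \<in> ?B"
    then show ?thesis using a block_trail(4)[OF _ assms] by blast
  next
    assume "(u, ds) \<in> cross_trails m"
    then show ?thesis using a by (rule cross_valid)
  qed
  show "(u, ds) = (u', ds')"
    if "(u, ds) \<in> ?T" "(u', ds') \<in> ?T" "(\<kappa>, d) \<in> set (?arcs u ds)"
      "(\<kappa>, d) \<in> set (?arcs u' ds')" for u ds u' ds' \<kappa> d
  proof -
    note arc = that(3,4)
    have "(u, ds) = (u', ds')" if "(u, ds) \<in> ?B" "(u', ds') \<in> ?B"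
    proof -
      from that obtain r i r' j where *: "i < m" "(u, ds) = ((False, False, r), block m i)"
        "j < m" "(u', ds') = ((False, False, r'), block m j)"
        by blast
      then show ?thesis
        using block_disjoint[OF *(1,3), of "(\<kappa>, d)" r r'] arc by simp
    qed
    then show ?thesis
      using that(1,2) block_cross[OF _ _ arc] block_cross[OF _ _ arc(2,1)]
        cross_disjoint[OF _ _ arc] by blast
  qed
  show "\<exists>(u, ds) \<in> ?T. (\<kappa>, d) \<in> set (?arcs u ds)"
    if d: "d \<in> {1..?c}" and fw: "forward ?c \<kappa> d" for \<kappa> d
  proof -
    obtain p q r where \<kappa>: "\<kappa> = (p, q, r)" by (cases \<kappa>)
    show ?thesis
    proof (cases "d = ?c")
      case True
      \<comment> \<open>A forward arc in direction \<open>?c\<close> leaves the face without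
        \<open>?c\<close>; each of the four possible tails has its own cross trail.\<close>
      then have "\<not> r" using fw \<kappa> by simp
      have "(\<kappa>, d) \<in> (\<Union>(u, ds) \<in> cross_trails m. set (?arcs u ds))"
        unfolding cross_arcs \<kappa> using True \<open>\<not> r\<close> by (cases p; cases q) simp_all
      then show ?thesis by blast
    next
      case False
      then obtain i where i: "i < m" "(\<kappa>, d) \<in> set (?arcs (False, False, r) (block m i))"
        using block_cover[of d m p q r] d fw \<kappa> by auto
      show ?thesis
      proof (cases "i \<noteq> 1 \<and> \<not> (r \<and> i = 0)")
        case True
        then show ?thesis
          using i by (intro bexI[of _ "((False, False, r), block m i)"]) auto
      next
        case False
        \<comment> \<open>The block containing the arc has been removed, so the arc is sought among
          the cross trails.\<close>
        then have "(\<kappa>, d) \<in> set (?arcs (False, False, r) (block m 1)) \<or>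
            r \<and> (\<kappa>, d) \<in> set (?arcs (False, False, r) (block m 0))"
          using i by auto
        moreover have "set (?arcs (False, False, r) (block m 1)) \<subseteq> (\<Union>(u, ds) \<in> cross_trails m. set (?arcs u ds))"
          unfolding cross_arcs blocks by (cases r) simp_all
        moreover have "set (?arcs (False, False, True) (block m 0)) \<subseteq> (\<Union>(u, ds) \<in> cross_trails m. set (?arcs u ds))"
          unfolding cross_arcs blocks by simp
        ultimately have "(\<kappa>, d) \<in> (\<Union>(u, ds) \<in> cross_trails m. set (?arcs u ds))"
          by (cases r) (simp_all only: simp_thms, blast+)
        then show ?thesis by blast
      qed
    qed
  qed
qed simp

theorem theorem2:
  fixes n :: nat
  assumes "n \<ge> 4"
  shows "divides (path_graph 4) (hypercube n)"
proof (cases "even n")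
  case True
  then show ?thesis
    using assms divides_hypercube_even by (auto elim!: evenE)
next
  case False
  then show ?thesis
    using assms divides_hypercube_odd by (auto elim!: oddE)
qed

end
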